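(* The deterministic competitive ratio of the hard $2$-taxi problem (on general metric spaces) is exactly $9$.
   Context: **Hard $k$-taxi problem** (here $k=2$). Let $(M,d)$ be a metric space. A configuration is a multiset of $k$ points of $M$ (the taxi positions). Given an initial configuration and a sequence of requests $\sigma=(r_1,\dots,r_n)$ with $r_i=(s_i,t_i)\in M^2$, an algorithm must move the taxis so as to serve the requests in order; a taxi serves $r_i$ by first moving to $s_i$ and then to $t_i$. The cost is the total distance travelled by all taxis, except that the movement of the serving taxi from $s_i$ to $t_i$ is not counted. An online algorithm must serve each request without knowledge of future requests. **Competitiveness.** A deterministic online algorithm $A$ is $\rho$-competitive if $\mathrm{cost}_A(\sigma)\le \rho\,\mathrm{OPT}(\sigma)+c$ for every request sequence $\sigma$, where $\mathrm{OPT}(\sigma)$ is the optimal offline cost of serving $\sigma$ from the same initial configuration and $c$ is a constant independent of $\sigma$. The deterministic competitive ratio of the problem on general metric spaces is the infimum of all $\rho$ such that there is a deterministic online algorithm that is $\rho$-competitive on every metric space. *)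

theory Defs
  imports "HOL-Analysis.Analysis" "HOL-Library.Multiset" "HOL-Library.Extended_Real"
begin

type_synonym 'a config = "'a multiset"

type_synonym 'a request = "'a \<times> 'a"

text \<open>
  One element \<open>(p, q)\<close> per taxi: the taxi at \<open>p\<close> drives to \<open>q\<close> (taxis with \<open>p = q\<close> stay put).
\<close>
type_synonym 'a move = "('a \<times> 'a) multiset"

definition move_cost :: "('a \<Rightarrow> 'a \<Rightarrow> real) \<Rightarrow> 'a move \<Rightarrow> real" where
  "move_cost d T = (\<Sum>(p, q)\<in>#T. d p q)"

text \<open>
  A request \<open>(s, t)\<close> is handled in two phases. First a move \<open>T\<close>, which is paid for and may involve
  any of the taxis, brings some taxi to \<open>s\<close>; then one taxi at \<open>s\<close> is relocated to \<open>t\<close> for free.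
  Driving between the drop-off at \<open>t\<close> and the next request is part of the move for the
  next request.
\<close>
definition serving_move :: "'a set \<Rightarrow> 'a config \<Rightarrow> 'a request \<Rightarrow> 'a move \<Rightarrow> bool" where
  "serving_move M C r T \<longleftrightarrow>
     image_mset fst T = C \<and> set_mset (image_mset snd T) \<subseteq> M \<and> fst r \<in># image_mset snd T"

definition config_after :: "'a request \<Rightarrow> 'a move \<Rightarrow> 'a config" where
  "config_after r T = add_mset (snd r) (image_mset snd T - {#fst r#})"

fun valid_schedule :: "'a set \<Rightarrow> 'a config \<Rightarrow> 'a request list \<Rightarrow> 'a move list \<Rightarrow> bool" where
  "valid_schedule M C [] [] \<longleftrightarrow> True"
| "valid_schedule M C (r # rs) (T # Ts) \<longleftrightarrow>
     serving_move M C r T \<and> valid_schedule M (config_after r T) rs Ts"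
| "valid_schedule M C _ _ \<longleftrightarrow> False"

definition schedule_cost :: "('a \<Rightarrow> 'a \<Rightarrow> real) \<Rightarrow> 'a move list \<Rightarrow> real" where
  "schedule_cost d Ts = (\<Sum>T\<leftarrow>Ts. move_cost d T)"

definition opt_cost :: "'a set \<Rightarrow> ('a \<Rightarrow> 'a \<Rightarrow> real) \<Rightarrow> 'a config \<Rightarrow> 'a request list \<Rightarrow> real" where
  "opt_cost M d C \<sigma> = Inf {schedule_cost d Ts | Ts. valid_schedule M C \<sigma> Ts}"

definition initial_config :: "nat \<Rightarrow> 'a set \<Rightarrow> 'a config \<Rightarrow> bool" where
  "initial_config k M C \<longleftrightarrow> size C = k \<and> set_mset C \<subseteq> M"

text \<open>
  A deterministic online algorithm is given the metric space, the initial configuration and the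
  nonempty list of the requests revealed so far, and returns its move for the last of these.
\<close>
type_synonym 'a algorithm =
  "'a set \<Rightarrow> ('a \<Rightarrow> 'a \<Rightarrow> real) \<Rightarrow> 'a config \<Rightarrow> 'a request list \<Rightarrow> 'a move"

definition run ::
  "'a algorithm \<Rightarrow> 'a set \<Rightarrow> ('a \<Rightarrow> 'a \<Rightarrow> real) \<Rightarrow> 'a config \<Rightarrow> 'a request list \<Rightarrow> 'a move list" where
  "run A M d C \<sigma> = map (\<lambda>i. A M d C (take (Suc i) \<sigma>)) [0..<length \<sigma>]"

definition online_algorithm :: "nat \<Rightarrow> 'a algorithm \<Rightarrow> bool" where
  "online_algorithm k A \<longleftrightarrow>
     (\<forall>M d C \<sigma>. Metric_space M d \<and> initial_config k M C \<and> set \<sigma> \<subseteq> M \<times> M \<longrightarrow>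
        valid_schedule M C \<sigma> (run A M d C \<sigma>))"

definition competitive ::
  "nat \<Rightarrow> 'a algorithm \<Rightarrow> 'a set \<Rightarrow> ('a \<Rightarrow> 'a \<Rightarrow> real) \<Rightarrow> real \<Rightarrow> bool" where
  "competitive k A M d \<rho> \<longleftrightarrow>
     (\<forall>C. initial_config k M C \<longrightarrow>
        (\<exists>c. \<forall>\<sigma>. set \<sigma> \<subseteq> M \<times> M \<longrightarrow>
           schedule_cost d (run A M d C \<sigma>) \<le> \<rho> * opt_cost M d C \<sigma> + c))"

text \<open>
  The metric spaces range over all carriers \<open>M :: 'a set\<close> and all metrics on \<open>M\<close>. The infimum is
  taken in the extended reals, so that it is \<open>\<infinity>\<close> if there is no competitive algorithm.
\<close>
definition hard_taxi_ratio :: "'a itself \<Rightarrow> nat \<Rightarrow> ereal" where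
  "hard_taxi_ratio (_ :: 'a itself) k =
     Inf {ereal \<rho> | \<rho>. \<exists>A :: 'a algorithm. online_algorithm k A \<and>
            (\<forall>M d. Metric_space M d \<longrightarrow> competitive k A M d \<rho>)}"

end

theory Submission
  imports Defs
begin

text \<open>
  Upper bound. After every request some taxi is at the drop-off \<open>t\<close>, so a configuration is determined
  by the other taxi. The algorithm keeps a virtual position of the other taxi, and on a request at
  \<open>s\<close> moves the taxi at \<open>t\<close> with speed 1 and the virtual taxi with speed 2 towards \<open>s\<close>, until one
  of them arrives; the real taxis only move in order to serve. Three times the distance
  from the virtual taxi to the other taxi of the adversary, plus the distance from the virtual to the
  real taxi, is a potential that shows 9-competitiveness. As the space need not contain
  intermediate points, the virtual position is an abstract one-point extension of the space.

  Lower bound. On the integer line, the adversary can make the algorithm play the cow path problem: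
  two offline configurations, whose second taxis are at \<open>- a\<close> and at \<open>b\<close>, have costs
  \<open>b\<close> and \<open>a\<close>, and a request between these two can always be arranged to be expensive for the
  configuration chosen by the algorithm: it costs 1 to stay and \<open>a + b\<close> to switch. No strategy for
  the cow path problem is better than 9-competitive.
\<close>

section \<open>Configurations of two taxis\<close>

lemma serving_move_two:
  assumes "serving_move M {#t, x#} (s, t') T"
  obtains p q where "T = {#(t, p), (x, q)#}" "p \<in> M" "q \<in> M"
    "p = s \<and> config_after (s, t') T = {#t', q#} \<or> q = s \<and> config_after (s, t') T = {#t', p#}"
proof -
  have im: "image_mset fst T = {#t, x#}"
    using assms by (simp add: serving_move_def)
  obtain u T1 where u: "T = add_mset u T1" "fst u = t" "image_mset fst T1 = {#x#}"
    using im by (auto dest!: msed_map_invR)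
  obtain v where v: "T1 = {#v#}" "fst v = x"
    using u(3) by (auto dest!: msed_map_invR)
  obtain p q where pq: "u = (t, p)" "v = (x, q)"
    using u v by (metis prod.collapse)
  have T: "T = {#(t, p), (x, q)#}"
    using u v pq by simp
  show thesis
    by (rule that[OF T]) (use assms T in \<open>auto simp: serving_move_def config_after_def\<close>)
qed

lemma serving_move_first:
  "s \<in> M \<Longrightarrow> q \<in> M \<Longrightarrow> serving_move M {#t, x#} (s, t') {#(t, s), (x, q)#}"
  by (auto simp: serving_move_def)

lemma serving_move_second:
  "s \<in> M \<Longrightarrow> p \<in> M \<Longrightarrow> serving_move M {#t, x#} (s, t') {#(t, p), (x, s)#}"
  by (auto simp: serving_move_def)

lemma config_after_first: "config_after (s, t') {#(t, s), (x, q)#} = {#t', q#}"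
  by (simp add: config_after_def)

lemma config_after_second: "config_after (s, t') {#(t, p), (x, s)#} = {#t', p#}"
  by (simp add: config_after_def)

lemma move_cost_two: "move_cost d {#(t, p), (x, q)#} = d t p + d x q"
  by (simp add: move_cost_def)

lemma schedule_cost_Nil: "schedule_cost d [] = 0"
  by (simp add: schedule_cost_def)

lemma schedule_cost_Cons: "schedule_cost d (T # Ts) = move_cost d T + schedule_cost d Ts"
  by (simp add: schedule_cost_def)

lemma schedule_cost_snoc: "schedule_cost d (Ts @ [T]) = schedule_cost d Ts + move_cost d T"
  by (simp add: schedule_cost_def)

lemma schedule_cost_nonneg:
  assumes "\<And>x y. 0 \<le> d x y"
  shows "0 \<le> schedule_cost d Ts"
proof -
  have "0 \<le> move_cost d T" for T
    by (induction T) (auto simp: move_cost_def assms add_nonneg_nonneg)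
  then show ?thesis
    unfolding schedule_cost_def by (auto intro!: sum_list_nonneg)
qed

lemma two_configE:
  assumes "initial_config 2 M C"
  obtains t x where "C = {#t, x#}" "t \<in> M" "x \<in> M"
proof -
  have size: "size C = Suc (Suc 0)" and M: "set_mset C \<subseteq> M"
    using assms by (auto simp: initial_config_def)
  obtain t C' where C': "C = add_mset t C'" "size C' = Suc 0"
    using size size_eq_Suc_imp_eq_union[OF size] by auto
  obtain x where "C' = {#x#}"
    using C'(2) size_1_singleton_mset[of C'] by auto
  with C' M that show thesis by auto
qed

section \<open>The upper bound\<close>

text \<open>
  A state \<open>(t, z, \<phi>)\<close> consists of the last drop-off, the other taxi and the distance function of the
  virtual taxi, an arbitrary function that satisfies the triangle inequalities.
\<close>
type_synonym 'a state = "'a \<times> 'a \<times> ('a \<Rightarrow> real)"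

text \<open>The taxi at \<open>t\<close> would reach \<open>s\<close> at time \<open>d t s\<close>,
  the virtual one at time \<open>\<phi> s / 2\<close>. The earlier one serves.\<close>

fun next_move :: "('a \<Rightarrow> 'a \<Rightarrow> real) \<Rightarrow> 'a state \<Rightarrow> 'a request \<Rightarrow> 'a move" where
  "next_move d (t, z, \<phi>) (s, t') =
     (if 2 * d t s \<le> \<phi> s then {#(t, s), (z, z)#} else {#(t, t), (z, s)#})"

text \<open>Each \<open>min\<close> is the distance from a point inside a segment ending at
  \<open>s\<close>: the way to \<open>y\<close> leaves through one end or the other. In the first
  case the virtual taxi has advanced by \<open>2 * d t s\<close>; in the second it has arrived, and
  the taxi left at \<open>t\<close> has virtually advanced by \<open>\<phi> s / 2\<close>.\<close>

fun next_state :: "('a \<Rightarrow> 'a \<Rightarrow> real) \<Rightarrow> 'a request \<Rightarrow> 'a state \<Rightarrow> 'a state" where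
  "next_state d (s, t') (t, z, \<phi>) =
     (if 2 * d t s \<le> \<phi> s
      then (t', z, \<lambda>y. min (\<phi> y + 2 * d t s) (\<phi> s - 2 * d t s + d s y))
      else (t', t, \<lambda>y. min (\<phi> s / 2 + d t y) (d t s - \<phi> s / 2 + d s y)))"

text \<open>A multiset does not tell which taxi counts as last dropped off, so one is chosen; the
  virtual taxi starts at the other.\<close>

definition initial_state :: "('a \<Rightarrow> 'a \<Rightarrow> real) \<Rightarrow> 'a config \<Rightarrow> 'a state" where
  "initial_state d C = (SOME (t, z, \<phi>). C = {#t, z#} \<and> \<phi> = d z)"

definition biased_double_coverage :: "'a algorithm" where
  "biased_double_coverage M d C \<sigma> =
     next_move d (fold (next_state d) (butlast \<sigma>) (initial_state d C)) (last \<sigma>)"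

fun moves_from :: "('a \<Rightarrow> 'a \<Rightarrow> real) \<Rightarrow> 'a state \<Rightarrow> 'a request list \<Rightarrow> 'a move list" where
  "moves_from d S [] = []"
| "moves_from d S (r # rs) = next_move d S r # moves_from d (next_state d r S) rs"

text \<open>These are the Katetov functions on \<open>M\<close>, the distance functions of one-point
  pseudometric extensions. The case \<open>x = y\<close> gives nonnegativity.\<close>

definition virtual_distance :: "'a set \<Rightarrow> ('a \<Rightarrow> 'a \<Rightarrow> real) \<Rightarrow> ('a \<Rightarrow> real) \<Rightarrow> bool" where
  "virtual_distance M d \<phi> \<longleftrightarrow>
     (\<forall>x\<in>M. \<forall>y\<in>M. \<phi> x \<le> \<phi> y + d x y \<and> d x y \<le> \<phi> x + \<phi> y)"

fun good_state :: "'a set \<Rightarrow> ('a \<Rightarrow> 'a \<Rightarrow> real) \<Rightarrow> 'a state \<Rightarrow> bool" where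
  "good_state M d (t, z, \<phi>) \<longleftrightarrow> t \<in> M \<and> z \<in> M \<and> virtual_distance M d \<phi>"

lemma virtual_distanceD:
  assumes "virtual_distance M d \<phi>" "x \<in> M" "y \<in> M"
  shows "\<phi> x \<le> \<phi> y + d x y" "d x y \<le> \<phi> x + \<phi> y"
  using assms by (auto simp: virtual_distance_def)

section \<open>Recursive form of the run and feasibility of the moves\<close>

lemma moves_from_eq_map:
  "moves_from d S \<sigma> =
     map (\<lambda>i. next_move d (fold (next_state d) (take i \<sigma>) S) (\<sigma> ! i)) [0..<length \<sigma>]"
proof (induction \<sigma> arbitrary: S)
  case Nil
  show ?case by simp
next
  case (Cons r rs)
  show ?case
    by (simp only: moves_from.simps Cons.IH length_Cons map_upt_Suc) simp
qed

lemma run_biased_double_coverage: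
  "run biased_double_coverage M d C \<sigma> = moves_from d (initial_state d C) \<sigma>"
  unfolding run_def moves_from_eq_map
  by (rule map_cong) (auto simp: biased_double_coverage_def take_Suc_conv_app_nth)

text \<open>Gluing in a segment and stopping inside it preserves the triangle inequalities: the two
  offsets in each \<open>min\<close> are nonnegative and add up to the distance of the endpoints,
  \<open>\<phi> s\<close> or \<open>d t s\<close>.\<close>

lemma good_state_next:
  assumes "Metric_space M d" "good_state M d S" "r \<in> M \<times> M"
  shows "good_state M d (next_state d r S)"
proof -
  interpret Metric_space M d by fact
  obtain t z \<phi> where S: "S = (t, z, \<phi>)" by (cases S)
  obtain s t' where r: "r = (s, t')" by (cases r)
  have M: "t \<in> M" "z \<in> M" "s \<in> M" "t' \<in> M" and \<phi>: "virtual_distance M d \<phi>"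
    using assms S r by auto
  note \<phi>D = virtual_distanceD[OF \<phi>]
  show ?thesis
  proof (cases "2 * d t s \<le> \<phi> s")
    case True
    have "virtual_distance M d (\<lambda>y. min (\<phi> y + 2 * d t s) (\<phi> s - 2 * d t s + d s y))"
      unfolding virtual_distance_def
    proof (intro ballI)
      fix x y assume xy: "x \<in> M" "y \<in> M"
      have "d s x \<le> d s y + d x y" "d x y \<le> d s x + d s y"
        using triangle[of s y x] triangle[of x s y] xy M commute by auto
      then show "min (\<phi> x + 2 * d t s) (\<phi> s - 2 * d t s + d s x)
            \<le> min (\<phi> y + 2 * d t s) (\<phi> s - 2 * d t s + d s y) + d x y \<and>
          d x y \<le> min (\<phi> x + 2 * d t s) (\<phi> s - 2 * d t s + d s x)
            + min (\<phi> y + 2 * d t s) (\<phi> s - 2 * d t s + d s y)"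
        using True \<phi>D[OF xy] \<phi>D[OF xy(1) M(3)] \<phi>D[OF xy(2) M(3)] nonneg[of t s]
          commute[of s x] commute[of s y]
        by (intro conjI; linarith)
    qed
    then show ?thesis using True M S r by simp
  next
    case False
    have "virtual_distance M d (\<lambda>y. min (\<phi> s / 2 + d t y) (d t s - \<phi> s / 2 + d s y))"
      unfolding virtual_distance_def
    proof (intro ballI)
      fix x y assume xy: "x \<in> M" "y \<in> M"
      have "d s x \<le> d s y + d x y" "d x y \<le> d s x + d s y"
        "d t x \<le> d t y + d x y" "d x y \<le> d t x + d t y"
        "d x y \<le> d t s + d t x + d s y" "d x y \<le> d t s + d s x + d t y"
        using triangle[of s y x] triangle[of x s y] triangle[of t y x] triangle[of x t y]
          triangle[of t s x] triangle[of t s y] xy M commute by auto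
      then show "min (\<phi> s / 2 + d t x) (d t s - \<phi> s / 2 + d s x)
            \<le> min (\<phi> s / 2 + d t y) (d t s - \<phi> s / 2 + d s y) + d x y \<and>
          d x y \<le> min (\<phi> s / 2 + d t x) (d t s - \<phi> s / 2 + d s x)
            + min (\<phi> s / 2 + d t y) (d t s - \<phi> s / 2 + d s y)"
        using False \<phi>D[OF M(3) M(3)] mdist_zero[OF M(3)]
        by (auto simp: min_def)
    qed
    then show ?thesis using False M S r by simp
  qed
qed

lemma moves_from_valid:
  assumes "Metric_space M d" "good_state M d (t, z, \<phi>)" "set \<sigma> \<subseteq> M \<times> M"
  shows "valid_schedule M {#t, z#} \<sigma> (moves_from d (t, z, \<phi>) \<sigma>)"
  using assms(2,3)
proof (induction \<sigma> arbitrary: t z \<phi>)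
  case Nil
  show ?case by simp
next
  case (Cons r rs)
  obtain s t' where r: "r = (s, t')" by (cases r)
  have "good_state M d (next_state d r (t, z, \<phi>))"
    using good_state_next[OF assms(1) Cons.prems(1)] Cons.prems(2) by simp
  with Cons.IH Cons.prems show ?case
    by (auto simp: r serving_move_first serving_move_second config_after_first
        config_after_second simp del: good_state.simps split: if_splits)
       (auto simp: serving_move_first serving_move_second)
qed

text \<open>Algorithm and adversary share the taxi at \<open>t\<close>, so the potential
  \<open>\<phi> z + 3 * \<phi> x\<close> involves only their other taxis. At each request, cost plus
  change of potential is at most 9 times the adversary's cost, and the final potential is
  nonnegative.\<close>

lemma moves_from_cost:
  assumes "Metric_space M d" "good_state M d (t, z, \<phi>)" "set \<sigma> \<subseteq> M \<times> M" "x \<in> M"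
    "valid_schedule M {#t, x#} \<sigma> Ts"
  shows "schedule_cost d (moves_from d (t, z, \<phi>) \<sigma>) \<le> 9 * schedule_cost d Ts + \<phi> z + 3 * \<phi> x"
  using assms(2-5)
proof (induction \<sigma> arbitrary: t z \<phi> x Ts)
  case Nil
  then have "0 \<le> \<phi> z" "0 \<le> \<phi> x" "Ts = []"
    using virtual_distanceD(2)[of M d \<phi> z z] virtual_distanceD(2)[of M d \<phi> x x]
      Metric_space.mdist_zero[OF assms(1)] by (auto elim: valid_schedule.elims)
  then show ?case by (simp add: schedule_cost_Nil)
next
  case (Cons r rs)
  interpret Metric_space M d by (rule assms(1))
  obtain s t' where r: "r = (s, t')" by (cases r)
  have M: "t \<in> M" "z \<in> M" "s \<in> M" "t' \<in> M" "x \<in> M" and \<phi>: "virtual_distance M d \<phi>"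
    using Cons.prems r by auto
  obtain T Ts' where Ts: "Ts = T # Ts'" and T: "serving_move M {#t, x#} (s, t') T"
    and Ts': "valid_schedule M (config_after (s, t') T) rs Ts'"
    using Cons.prems(4) r by (cases Ts) auto
  obtain p q where pq: "T = {#(t, p), (x, q)#}" "p \<in> M" "q \<in> M"
    "p = s \<and> config_after (s, t') T = {#t', q#} \<or> q = s \<and> config_after (s, t') T = {#t', p#}"
    using serving_move_two[OF T] by blast
  obtain z' \<phi>' where S': "next_state d r (t, z, \<phi>) = (t', z', \<phi>')"
    by (cases "2 * d t s \<le> \<phi> s") (auto simp: r)
  have good: "good_state M d (t', z', \<phi>')"
    using good_state_next[OF assms(1) Cons.prems(1)] Cons.prems(2) S'
    by (metis list.set_intros(1) subsetD)
  then have \<phi>': "virtual_distance M d \<phi>'" by simp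
  obtain y where y: "y \<in> M" "config_after (s, t') T = {#t', y#}"
    "p = s \<and> y = q \<or> q = s \<and> y = p"
    using pq by blast
  have IH: "schedule_cost d (moves_from d (t', z', \<phi>') rs)
      \<le> 9 * schedule_cost d Ts' + \<phi>' z' + 3 * \<phi>' y"
    using Cons.IH[OF good] Cons.prems(2) y Ts' by auto
  have step: "move_cost d (next_move d (t, z, \<phi>) r) + \<phi>' z' + 3 * \<phi>' y
      \<le> 9 * (d t p + d x q) + \<phi> z + 3 * \<phi> x"
  proof -
    note D = virtual_distanceD[OF \<phi>] virtual_distanceD[OF \<phi>']
    have tri: "d s x \<le> \<phi> s + \<phi> x" "d s z \<le> \<phi> s + \<phi> z" "\<phi> s \<le> \<phi> x + d x s"
      "\<phi>' q \<le> \<phi>' x + d x q" "\<phi>' p \<le> \<phi>' t + d t p" "d z s = d s z"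
      "0 \<le> d t s" "0 \<le> \<phi> s" "0 \<le> d t p" "0 \<le> d x q"
      using D(2)[OF M(3) M(5)] D(2)[OF M(3) M(2)] D(1)[OF M(3) M(5)] D(2)[OF M(3) M(3)]
        D(3)[OF pq(3) M(5)] D(3)[OF pq(2) M(1)] commute mdist_zero M by auto
    have zero: "d z z = 0" "d t t = 0" "d s s = 0" using M by auto
    have served: "d t p = d t s \<and> \<phi>' y = \<phi>' q \<or> d x q = d x s \<and> \<phi>' y = \<phi>' p"
      using y(3) by auto
    show ?thesis
    proof (cases "2 * d t s \<le> \<phi> s")
      case True
      then have eq: "z' = z" "\<phi>' = (\<lambda>y. min (\<phi> y + 2 * d t s) (\<phi> s - 2 * d t s + d s y))"
        using S' by (auto simp: r)
      \<comment> \<open>If the adversary also serves from \<open>t\<close>, cost and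
        \<open>\<phi>' z\<close> add \<open>3 * d t s\<close> and the weighted term adds
        \<open>6 * d t s\<close>, which accounts for the 9. If it serves from \<open>x\<close>, the
        bound on \<open>\<phi>' t\<close> saves \<open>3 * d t s\<close>.\<close>
      have "\<phi>' z \<le> \<phi> z + 2 * d t s" "\<phi>' x \<le> \<phi> x + 2 * d t s" "\<phi>' t \<le> \<phi> s - d t s"
        using commute[of s t] by (auto simp: eq)
      moreover have "move_cost d (next_move d (t, z, \<phi>) r) = d t s"
        using True zero by (simp add: r move_cost_two)
      ultimately show ?thesis
        using served tri(3-5,7-10) unfolding eq(1) by argo
    next
      case False
      then have eq: "z' = t" "\<phi>' = (\<lambda>y. min (\<phi> s / 2 + d t y) (d t s - \<phi> s / 2 + d s y))"
        using S' by (auto simp: r)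
      \<comment> \<open>Cost and \<open>\<phi>' t\<close> amount to at most
        \<open>\<phi> z + 3/2 * \<phi> s\<close>. If the adversary serves from \<open>t\<close>, the
        weighted term adds another \<open>3/2 * \<phi> s\<close> and \<open>3 * d t s\<close>; as
        \<open>\<phi> s < 2 * d t s\<close>, the sum stays below \<open>9 * d t s\<close>.\<close>
      have "\<phi>' t \<le> \<phi> s / 2 + d t t" "\<phi>' x \<le> d t s - \<phi> s / 2 + d s x"
        unfolding eq by (rule min.cobounded1, rule min.cobounded2)
      moreover have "move_cost d (next_move d (t, z, \<phi>) r) = d s z"
        using False zero tri(6) by (simp add: r move_cost_two)
      ultimately show ?thesis
        using served False tri zero(2) unfolding eq(1) by argo
    qed
  qed
  show ?case
    using IH step by (simp add: Ts S' schedule_cost_Cons pq(1) move_cost_two)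
qed

section \<open>Initial configurations and competitiveness of the algorithm\<close>

lemma initial_state_cases:
  assumes "initial_config 2 M C"
  obtains t z where "C = {#t, z#}" "t \<in> M" "z \<in> M" "initial_state d C = (t, z, d z)"
proof -
  obtain t x where "C = {#t, x#}"
    using two_configE[OF assms] .
  then have "\<exists>S. case S of (t, z, \<phi>) \<Rightarrow> C = {#t, z#} \<and> \<phi> = d z"
    by auto
  from someI_ex[OF this] obtain t z where tz: "C = {#t, z#}" "initial_state d C = (t, z, d z)"
    unfolding initial_state_def by (cases "SOME (t, z, \<phi>). C = {#t, z#} \<and> \<phi> = d z") auto
  moreover have "t \<in> M" "z \<in> M"
    using assms tz by (auto simp: initial_config_def)
  ultimately show thesis using that by blast
qed

lemma good_state_initial:
  assumes "Metric_space M d" "t \<in> M" "z \<in> M"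
  shows "good_state M d (t, z, d z)"
proof -
  interpret Metric_space M d by fact
  show ?thesis
    using assms(2,3) triangle[of z] triangle[of _ z] commute
    by (auto simp: virtual_distance_def) metis+
qed

lemma biased_double_coverage_online: "online_algorithm 2 biased_double_coverage"
  unfolding online_algorithm_def
proof (intro allI impI, elim conjE)
  fix M :: "'a set" and d C \<sigma>
  assume M: "Metric_space M d" and C: "initial_config 2 M C" and \<sigma>: "set \<sigma> \<subseteq> M \<times> M"
  obtain t z where tz: "C = {#t, z#}" "t \<in> M" "z \<in> M" "initial_state d C = (t, z, d z)"
    using initial_state_cases[OF C] .
  show "valid_schedule M C \<sigma> (run biased_double_coverage M d C \<sigma>)"
    using moves_from_valid[OF M good_state_initial[OF M tz(2,3)] \<sigma>]
    by (simp add: run_biased_double_coverage tz(4) flip: tz(1))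
qed

lemma biased_double_coverage_competitive:
  assumes M: "Metric_space M d"
  shows "competitive 2 biased_double_coverage M d 9"
  unfolding competitive_def
\<comment> \<open>The additive constant is 0 because the initial potential vanishes:
  \<open>x = z\<close> and \<open>\<phi> = d z\<close>.\<close>
proof (intro allI impI exI[of _ 0])
  fix C \<sigma> assume C: "initial_config 2 M C" and \<sigma>: "set \<sigma> \<subseteq> M \<times> M"
  let ?R = "run biased_double_coverage M d C \<sigma>"
  obtain t z where tz: "C = {#t, z#}" "t \<in> M" "z \<in> M" "initial_state d C = (t, z, d z)"
    using initial_state_cases[OF C] .
  have valid: "valid_schedule M C \<sigma> ?R"
    using biased_double_coverage_online M C \<sigma> by (auto simp: online_algorithm_def)
  have "schedule_cost d ?R \<le> 9 * schedule_cost d Ts" if "valid_schedule M C \<sigma> Ts" for Ts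
    using moves_from_cost[OF M good_state_initial[OF M tz(2,3)] \<sigma> tz(3)] that
      Metric_space.mdist_zero[OF M tz(3)]
    by (simp add: run_biased_double_coverage tz(4) flip: tz(1))
  then have "schedule_cost d ?R / 9 \<le> opt_cost M d C \<sigma>"
    unfolding opt_cost_def using valid by (intro cInf_greatest) (auto simp: field_simps)
  then show "schedule_cost d ?R \<le> 9 * opt_cost M d C \<sigma> + 0"
    by simp
qed

section \<open>The cow path problem\<close>

text \<open>
  The numbers \<open>f\<close> and \<open>g\<close> are the depths of the branch where the algorithm is not and of the one
  where it is, and \<open>L\<close> is the cost of the algorithm. In terms of \<open>V = L - f - g\<close>, a bound
  \<open>V \<ge> \<mu> f - C\<close> can be improved to \<open>(\<rho> + \<mu>) / (\<rho> - 2 - \<mu>)\<close> in place of \<open>\<mu>\<close>, since the first bound and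
  competitiveness limit the depth at which the algorithm may switch. For \<open>\<rho> < 9\<close> this map
  has no fixed point.
\<close>
lemma cow_path:
  fixes f g L :: "nat \<Rightarrow> real"
  assumes init: "f 0 = 0" "g 0 = 0" "L 0 = 0"
    and step: "\<And>n. f (Suc n) = f n \<and> g (Suc n) = g n + 1 \<and> L (Suc n) = L n + 1 \<or>
      f (Suc n) = g n + 1 \<and> g (Suc n) = f n \<and> L (Suc n) = L n + f n + g n"
    and comp: "\<And>n. L n \<le> \<rho> * f n + c" "\<And>n. L n \<le> \<rho> * g n + c"
    and "8 \<le> \<rho>"
  shows "9 \<le> \<rho>"
proof (rule ccontr)
  assume "\<not> 9 \<le> \<rho>"
  define \<alpha> where "\<alpha> = \<rho> - 2"
  define V where "V n = L n - f n - g n" for n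
  define Q where "Q \<mu> \<longleftrightarrow> (\<exists>C\<ge>0. \<forall>n. \<mu> * f n - C \<le> V n)" for \<mu>
  have \<alpha>: "6 \<le> \<alpha>" "\<alpha> < 7" "\<rho> = \<alpha> + 2"
    using \<open>8 \<le> \<rho>\<close> \<open>\<not> 9 \<le> \<rho>\<close> by (auto simp: \<alpha>_def)
  have pos: "0 \<le> f n \<and> 0 \<le> g n" for n
  proof (induction n)
    case (Suc n)
    then show ?case using step[of n] by auto
  qed (simp add: init)
  have sum: "f n + g n = n" for n
  proof (induction n)
    case (Suc n)
    then show ?case using step[of n] by auto
  qed (simp add: init)
  \<comment> \<open>After a switch the branch of depth \<open>g (Suc n) = f n\<close> is the one
    whose bound limits \<open>L (Suc n)\<close>, hence also the new depth
    \<open>f (Suc n)\<close>.\<close>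
  have stay_or_switch: "f (Suc n) = f n \<and> V (Suc n) = V n \<or>
      V (Suc n) = V n + f n + f (Suc n) - 2 \<and>
      V n + 2 * f n + 2 * f (Suc n) - 2 \<le> \<rho> * f n + c" for n
    using step[of n] comp(2)[of "Suc n"] by (auto simp: V_def)
  have V0: "V 0 = 0" "f 0 = 0"
    using init by (auto simp: V_def)
  have mono: "Q \<mu>" if "Q \<mu>'" "\<mu> \<le> \<mu>'" for \<mu> \<mu>'
  proof -
    obtain C where "0 \<le> C" and C: "\<And>n. \<mu>' * f n - C \<le> V n"
      using \<open>Q \<mu>'\<close> by (auto simp: Q_def)
    have "\<mu> * f n - C \<le> V n" for n
      using C[of n] mult_right_mono[OF \<open>\<mu> \<le> \<mu>'\<close>, of "f n"] pos[of n] by linarith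
    with \<open>0 \<le> C\<close> show ?thesis by (auto simp: Q_def)
  qed
  have improve: "Q ((\<rho> + \<mu>) / (\<alpha> - \<mu>))" if "Q \<mu>" "0 \<le> \<mu>" "\<mu> < \<alpha>" for \<mu>
  proof -
    obtain C where "0 \<le> C" and C: "\<And>n. \<mu> * f n - C \<le> V n"
      using \<open>Q \<mu>\<close> by (auto simp: Q_def)
    \<comment> \<open>The constant that results from solving the competitiveness bound for
      \<open>F\<close> and inserting this into \<open>V (Suc n) = V n + F + G - 2\<close>; the slope
      becomes \<open>2 * (\<mu> + 1) / (\<alpha> - \<mu>) + 1\<close>.\<close>
    define C' where "C' = C + 2 + (\<mu> + 1) * (\<bar>c\<bar> + 2 + C) / (\<alpha> - \<mu>)"
    have "0 \<le> C'"
      using \<open>0 \<le> C\<close> that by (simp add: C'_def)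
    moreover have "(\<rho> + \<mu>) / (\<alpha> - \<mu>) * f n - C' \<le> V n" for n
    proof (induction n)
      case 0
      show ?case using \<open>0 \<le> C'\<close> by (simp add: V0)
    next
      case (Suc n)
      show ?case
      proof (cases "f (Suc n) = f n \<and> V (Suc n) = V n")
        case False
        define F G where "F = f n" and "G = f (Suc n)"
        have VG: "V (Suc n) = V n + F + G - 2" "V n + 2 * F + 2 * G - 2 \<le> \<rho> * F + c"
          using stay_or_switch[of n] False by (auto simp: F_def G_def)
        have "2 * G - (\<bar>c\<bar> + 2 + C) \<le> (\<alpha> - \<mu>) * F"
          using VG(2) C[of n] \<alpha>(3) by (simp add: F_def algebra_simps)
        then have "(2 * G - (\<bar>c\<bar> + 2 + C)) / (\<alpha> - \<mu>) \<le> F"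
          using that by (simp add: field_simps)
        then have "(\<mu> + 1) * ((2 * G - (\<bar>c\<bar> + 2 + C)) / (\<alpha> - \<mu>)) \<le> (\<mu> + 1) * F"
          using that by (intro mult_left_mono) auto
        moreover have "(\<mu> + 1) * ((2 * G - (\<bar>c\<bar> + 2 + C)) / (\<alpha> - \<mu>)) + G - C - 2
            = (\<rho> + \<mu>) / (\<alpha> - \<mu>) * G - C'"
          using that \<alpha>(3) by (simp add: C'_def divide_simps) (simp add: algebra_simps)
        ultimately have "(\<rho> + \<mu>) / (\<alpha> - \<mu>) * G - C' \<le> (\<mu> + 1) * F + G - C - 2"
          by linarith
        also have "\<dots> \<le> V (Suc n)"
          using VG(1) C[of n] by (simp add: F_def algebra_simps)
        finally show ?thesis by (simp add: G_def)
      qed (use Suc in simp)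
    qed
    ultimately show ?thesis by (auto simp: Q_def)
  qed
  \<comment> \<open>Completing the square, \<open>\<delta> * \<alpha>\<close> is the minimum of
    \<open>\<rho> + \<mu> - \<mu> * (\<alpha> - \<mu>)\<close> over \<open>\<mu>\<close>. It is
    positive because \<open>1 < \<rho> < 9\<close>, so every improvement gains at least
    \<open>\<delta>\<close>.\<close>
  define \<delta> where "\<delta> = (\<rho> - 1) * (9 - \<rho>) / (4 * \<alpha>)"
  have "0 < \<delta>"
    using \<alpha> by (simp add: \<delta>_def)
  have increment: "\<mu> + \<delta> \<le> (\<rho> + \<mu>) / (\<alpha> - \<mu>)" if "0 \<le> \<mu>" "\<mu> < \<alpha>" for \<mu>
  proof -
    have "(\<rho> - 1) * (9 - \<rho>) / 4 + (\<mu> - (\<rho> - 3) / 2)\<^sup>2 = \<rho> + \<mu> - \<mu> * (\<alpha> - \<mu>)"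
      by (simp add: \<alpha>_def power2_eq_square field_simps)
    then have "(\<rho> - 1) * (9 - \<rho>) / 4 \<le> \<rho> + \<mu> - \<mu> * (\<alpha> - \<mu>)"
      by (smt (verit) zero_le_power2)
    moreover have "\<delta> * (\<alpha> - \<mu>) \<le> \<delta> * \<alpha>"
      using \<open>0 < \<delta>\<close> that by simp
    moreover have "\<delta> * \<alpha> = (\<rho> - 1) * (9 - \<rho>) / 4"
      using \<alpha> by (simp add: \<delta>_def)
    ultimately have "(\<mu> + \<delta>) * (\<alpha> - \<mu>) \<le> \<rho> + \<mu>"
      unfolding distrib_right by linarith
    then show ?thesis using that by (simp add: field_simps)
  qed
  have "Q (min (real k * \<delta>) \<alpha>)" for k
  proof (induction k)
    case 0
    \<comment> \<open>Only a switch at \<open>n = 0\<close> lowers \<open>V\<close>, by 1: a switch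
      changes \<open>V\<close> by \<open>f n + g n - 1 = n - 1\<close>.\<close>
    have "- 1 \<le> V n" for n
    proof (induction n)
      case (Suc n)
      then show ?case using step[of n] sum[of n] pos[of n] by (cases n) (auto simp: V_def init)
    qed (simp add: V0)
    then show ?case using \<alpha> by (auto simp: Q_def intro!: exI[of _ 1])
  next
    case (Suc k)
    show ?case
    proof (cases "real k * \<delta> < \<alpha>")
      case True
      then have "Q (real k * \<delta>)" "0 \<le> real k * \<delta>"
        using Suc \<open>0 < \<delta>\<close> by (auto simp: min_def split: if_splits)
      then have "Q ((\<rho> + real k * \<delta>) / (\<alpha> - real k * \<delta>))"
        using True by (intro improve)
      moreover have "real k * \<delta> + \<delta> \<le> (\<rho> + real k * \<delta>) / (\<alpha> - real k * \<delta>)"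
        using True \<open>0 \<le> real k * \<delta>\<close> by (rule increment[rotated])
      moreover have "min (real (Suc k) * \<delta>) \<alpha> \<le> real k * \<delta> + \<delta>"
        by (simp add: algebra_simps)
      ultimately show ?thesis
        using mono order_trans by blast
    next
      case False
      then show ?thesis
        using Suc \<open>0 < \<delta>\<close> by (intro mono[OF Suc]) auto
    qed
  qed
  moreover obtain k where "\<alpha> / \<delta> < real k"
    using reals_Archimedean2 by blast
  then have "\<alpha> < real k * \<delta>"
    using \<open>0 < \<delta>\<close> by (simp add: field_simps)
  ultimately have "Q \<alpha>"
    by (metis min.absorb2 less_imp_le)
  then obtain C where "0 \<le> C" and C: "\<And>n. \<alpha> * f n - C \<le> V n"
    by (auto simp: Q_def)
  \<comment> \<open>With slope \<open>\<alpha> = \<rho> - 2\<close> the terms in \<open>f n\<close>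
    cancel in the condition for a switch, so only bounded depths can arise. But \<open>L n\<close>
    grows at least like \<open>n\<close>, which contradicts competitiveness.\<close>
  have bound: "f n \<le> \<bar>c\<bar> + 2 + C" for n
  proof (induction n)
    case (Suc n)
    show ?case
      using stay_or_switch[of n] C[of n] Suc \<open>0 \<le> C\<close> \<alpha>(3) pos[of "Suc n"]
      by (auto simp: algebra_simps)
  qed (use V0 \<open>0 \<le> C\<close> in simp)
  obtain n :: nat where n: "\<rho> * (\<bar>c\<bar> + 2 + C) + c + C < n"
    using reals_Archimedean2 by blast
  have "0 \<le> \<alpha> * f n"
    using pos[of n] \<alpha> by simp
  then have "n - C \<le> L n"
    using C[of n] sum[of n] by (simp add: V_def)
  moreover have "\<rho> * f n \<le> \<rho> * (\<bar>c\<bar> + 2 + C)"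
    using bound \<open>8 \<le> \<rho>\<close> by (intro mult_left_mono) auto
  ultimately show False
    using n comp(1)[of n] by linarith
qed

section \<open>The lower bound\<close>

text \<open>Records the final configuration, from which a schedule is extended by further
  requests.\<close>

fun reaches ::
  "'a set \<Rightarrow> 'a config \<Rightarrow> 'a request list \<Rightarrow> 'a move list \<Rightarrow> 'a config \<Rightarrow> bool" where
  "reaches M C [] [] C' \<longleftrightarrow> C = C'"
| "reaches M C (r # rs) (T # Ts) C' \<longleftrightarrow>
     serving_move M C r T \<and> reaches M (config_after r T) rs Ts C'"
| "reaches M C _ _ C' \<longleftrightarrow> False"

lemma reaches_imp_valid: "reaches M C \<sigma> Ts C' \<Longrightarrow> valid_schedule M C \<sigma> Ts"
  by (induction M C \<sigma> Ts rule: valid_schedule.induct) auto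

lemma reaches_snoc:
  assumes "reaches M C \<sigma> Ts C'" "serving_move M C' r T"
  shows "reaches M C (\<sigma> @ [r]) (Ts @ [T]) (config_after r T)"
  using assms by (induction M C \<sigma> Ts rule: valid_schedule.induct) auto

lemma serving_move_of_reaches:
  assumes "reaches M C \<sigma> Ts C'" "valid_schedule M C (\<sigma> @ [r]) (Ts @ [T])"
  shows "serving_move M C' r T"
  using assms by (induction M C \<sigma> Ts rule: valid_schedule.induct) auto

text \<open>The line is transported along an injection, so every infinite type carries a copy of
  it.\<close>

locale integer_line =
  fixes \<iota> :: "int \<Rightarrow> 'a" and A :: "'a algorithm"
  assumes inj: "inj \<iota>" and online: "online_algorithm 2 A"
begin

definition M :: "'a set" where "M = range \<iota>"

definition d :: "'a \<Rightarrow> 'a \<Rightarrow> real" where "d x y = real_of_int \<bar>inv \<iota> x - inv \<iota> y\<bar>"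

definition C0 :: "'a config" where "C0 = {#\<iota> 0, \<iota> 0#}"

abbreviation alg :: "'a request list \<Rightarrow> 'a move list" where "alg \<equiv> run A M d C0"

lemma d_line [simp]: "d (\<iota> i) (\<iota> j) = real_of_int \<bar>i - j\<bar>"
  by (simp add: d_def inj)

lemma in_line [simp]: "\<iota> i \<in> M"
  by (simp add: M_def)

lemma metric_line: "Metric_space M d"
proof
  fix x y assume "x \<in> M" "y \<in> M"
  then show "d x y = 0 \<longleftrightarrow> x = y"
    using inj by (auto simp: M_def inj_def)
qed (auto simp: d_def)

lemma initial_line: "initial_config 2 M C0"
  by (simp add: initial_config_def C0_def)

text \<open>\<open>w\<close> is an upper bound for the work function at the configuration with taxis
  at \<open>t\<close> and \<open>y\<close>.\<close>

definition offline :: "'a request list \<Rightarrow> int \<Rightarrow> int \<Rightarrow> int \<Rightarrow> bool" where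
  "offline \<sigma> t y w \<longleftrightarrow>
     (\<exists>Ts. reaches M C0 \<sigma> Ts {#\<iota> t, \<iota> y#} \<and> schedule_cost d Ts \<le> real_of_int w)"

text \<open>
  \<open>A\<close> is compared with a lazy algorithm that makes the same decisions: the latter has its taxis at
  \<open>t\<close> and \<open>y\<close> after paying \<open>L\<close>, and could still catch up with \<open>A\<close> without exceeding the cost of \<open>A\<close>.
\<close>
definition lazy :: "'a request list \<Rightarrow> int \<Rightarrow> int \<Rightarrow> int \<Rightarrow> bool" where
  "lazy \<sigma> t y L \<longleftrightarrow>
     (\<exists>x. reaches M C0 \<sigma> (alg \<sigma>) {#\<iota> t, \<iota> x#} \<and>
        real_of_int (L + \<bar>x - y\<bar>) \<le> schedule_cost d (alg \<sigma>))"

lemma offline_first: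
  assumes "offline \<sigma> t y w"
  shows "offline (\<sigma> @ [(\<iota> s, \<iota> t')]) t' y (w + \<bar>t - s\<bar>)"
proof -
  obtain Ts where Ts: "reaches M C0 \<sigma> Ts {#\<iota> t, \<iota> y#}" "schedule_cost d Ts \<le> real_of_int w"
    using assms by (auto simp: offline_def)
  show ?thesis
    using reaches_snoc[OF Ts(1) serving_move_first[of "\<iota> s" M "\<iota> y" "\<iota> t" "\<iota> y" "\<iota> t'"]] Ts(2)
    unfolding offline_def config_after_first
    by (intro exI[of _ "Ts @ [{#(\<iota> t, \<iota> s), (\<iota> y, \<iota> y)#}]"])
       (simp add: schedule_cost_snoc move_cost_two)
qed

lemma offline_second:
  assumes "offline \<sigma> t s w"
  shows "offline (\<sigma> @ [(\<iota> s, \<iota> t')]) t' t w"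
proof -
  obtain Ts where Ts: "reaches M C0 \<sigma> Ts {#\<iota> t, \<iota> s#}" "schedule_cost d Ts \<le> real_of_int w"
    using assms by (auto simp: offline_def)
  show ?thesis
    using reaches_snoc[OF Ts(1) serving_move_second[of "\<iota> s" M "\<iota> t" "\<iota> t" "\<iota> s" "\<iota> t'"]] Ts(2)
    unfolding offline_def config_after_second
    by (intro exI[of _ "Ts @ [{#(\<iota> t, \<iota> t), (\<iota> s, \<iota> s)#}]"])
       (simp add: schedule_cost_snoc move_cost_two)
qed

lemma run_snoc: "alg (\<sigma> @ [r]) = alg \<sigma> @ [A M d C0 (\<sigma> @ [r])]"
  by (simp add: run_def)

text \<open>The lazy algorithm serves with the same taxi as \<open>A\<close>. By the triangle
  inequality, any additional movement of \<open>A\<close> pays for the change of the gap between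
  their other taxis.\<close>

lemma lazy_request:
  assumes "lazy \<sigma> t y L" "set \<sigma> \<subseteq> M \<times> M"
  shows "lazy (\<sigma> @ [(\<iota> s, \<iota> t')]) t' y (L + \<bar>t - s\<bar>) \<or>
    lazy (\<sigma> @ [(\<iota> s, \<iota> t')]) t' t (L + \<bar>y - s\<bar>)"
proof -
  let ?\<sigma> = "\<sigma> @ [(\<iota> s, \<iota> t')]"
  obtain x where x: "reaches M C0 \<sigma> (alg \<sigma>) {#\<iota> t, \<iota> x#}"
    "real_of_int (L + \<bar>x - y\<bar>) \<le> schedule_cost d (alg \<sigma>)"
    using assms(1) by (auto simp: lazy_def)
  have "valid_schedule M C0 ?\<sigma> (alg ?\<sigma>)"
    using online metric_line initial_line assms(2) by (auto simp: online_algorithm_def)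
  then have T: "serving_move M {#\<iota> t, \<iota> x#} (\<iota> s, \<iota> t') (A M d C0 ?\<sigma>)"
    using serving_move_of_reaches[OF x(1)] by (simp add: run_snoc)
  then obtain p q where pq: "A M d C0 ?\<sigma> = {#(\<iota> t, \<iota> p), (\<iota> x, \<iota> q)#}"
    "\<iota> p = \<iota> s \<and> config_after (\<iota> s, \<iota> t') (A M d C0 ?\<sigma>) = {#\<iota> t', \<iota> q#} \<or>
     \<iota> q = \<iota> s \<and> config_after (\<iota> s, \<iota> t') (A M d C0 ?\<sigma>) = {#\<iota> t', \<iota> p#}"
    by (elim serving_move_two) (auto simp: M_def)
  have reach: "reaches M C0 ?\<sigma> (alg ?\<sigma>) (config_after (\<iota> s, \<iota> t') (A M d C0 ?\<sigma>))"
    using reaches_snoc[OF x(1) T] by (simp add: run_snoc)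
  have cost: "schedule_cost d (alg ?\<sigma>)
      = schedule_cost d (alg \<sigma>) + real_of_int (\<bar>t - p\<bar> + \<bar>x - q\<bar>)"
    by (simp add: run_snoc schedule_cost_snoc pq(1) move_cost_two)
  from pq(2) show ?thesis
  proof (elim disjE conjE)
    assume "\<iota> p = \<iota> s" and C: "config_after (\<iota> s, \<iota> t') (A M d C0 ?\<sigma>) = {#\<iota> t', \<iota> q#}"
    then have "p = s" using inj by (simp add: inj_def)
    then have "lazy ?\<sigma> t' y (L + \<bar>t - s\<bar>)"
      unfolding lazy_def using reach x(2) cost C by (intro exI[of _ q]) auto
    then show ?thesis ..
  next
    assume "\<iota> q = \<iota> s" and C: "config_after (\<iota> s, \<iota> t') (A M d C0 ?\<sigma>) = {#\<iota> t', \<iota> p#}"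
    then have "q = s" using inj by (simp add: inj_def)
    then have "lazy ?\<sigma> t' t (L + \<bar>y - s\<bar>)"
      unfolding lazy_def using reach x(2) cost C by (intro exI[of _ p]) auto
    then show ?thesis ..
  qed
qed

text \<open>Undoes a paid move from \<open>y\<close> to \<open>y'\<close>. Thus, for a request at
  \<open>t\<close>, sending the second taxi there is no better for the algorithm than using the taxi
  at \<open>t\<close>.\<close>

lemma lazy_move:
  assumes "lazy \<sigma> t y' (L + \<bar>y - y'\<bar>)"
  shows "lazy \<sigma> t y L"
proof -
  obtain x where "reaches M C0 \<sigma> (alg \<sigma>) {#\<iota> t, \<iota> x#}"
    "real_of_int (L + \<bar>y - y'\<bar> + \<bar>x - y'\<bar>) \<le> schedule_cost d (alg \<sigma>)"
    using assms by (auto simp: lazy_def)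
  then show ?thesis
    unfolding lazy_def by (intro exI[of _ x]) auto
qed

text \<open>The sign \<open>e\<close> tells on which side of the origin the second taxi of the lazy algorithm is.\<close>
definition game :: "'a request list \<Rightarrow> int \<Rightarrow> int \<Rightarrow> int \<Rightarrow> int \<Rightarrow> bool" where
  "game \<sigma> e f g L \<longleftrightarrow>
     set \<sigma> \<subseteq> M \<times> M \<and> \<bar>e\<bar> = 1 \<and> 0 \<le> f \<and> 0 \<le> g \<and>
     (\<exists>t. lazy \<sigma> t (- e * f) L \<and> offline \<sigma> t (- e * f) g \<and> offline \<sigma> t (e * g) f)"

lemma game_init: "game [] 1 0 0 0"
  by (auto simp: game_def lazy_def offline_def run_def C0_def schedule_cost_Nil
      intro!: exI[of _ 0] exI[of _ "[]"])

lemma game_step: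
  assumes "game \<sigma> e f g L"
  shows "\<exists>\<sigma>'. game \<sigma>' e f (g + 1) (L + 1) \<or> game \<sigma>' (- e) (g + 1) f (L + f + g)"
proof -
  obtain t where \<sigma>: "set \<sigma> \<subseteq> M \<times> M" and e: "\<bar>e\<bar> = 1" and fg: "0 \<le> f" "0 \<le> g"
    and t: "lazy \<sigma> t (- e * f) L" "offline \<sigma> t (- e * f) g" "offline \<sigma> t (e * g) f"
    using assms by (auto simp: game_def)
  let ?t = "e * (g + 1)"
  \<comment> \<open>Every configuration has a taxi at \<open>t\<close>, so this request relocates it
    at no cost, one step beyond \<open>e * g\<close>.\<close>
  define \<sigma>1 where "\<sigma>1 = \<sigma> @ [(\<iota> t, \<iota> ?t)]"
  \<comment> \<open>The rival offline configuration has its second taxi at \<open>e * g\<close> and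
    serves for free; its other taxi remains at \<open>?t\<close>, which moves its branch one step
    outwards.\<close>
  define \<sigma>2 where "\<sigma>2 = \<sigma>1 @ [(\<iota> (e * g), \<iota> (e * g))]"
  have \<sigma>1: "set \<sigma>1 \<subseteq> M \<times> M" and \<sigma>2: "set \<sigma>2 \<subseteq> M \<times> M"
    using \<sigma> by (auto simp: \<sigma>1_def \<sigma>2_def)
  have near: "\<bar>?t - e * g\<bar> = 1" and far: "\<bar>- e * f - e * g\<bar> = f + g"
    using e fg by (auto simp: algebra_simps abs_if split: if_splits)
  have "lazy \<sigma>1 ?t (- e * f) L"
    using lazy_request[OF t(1) \<sigma>, of t ?t] lazy_move unfolding \<sigma>1_def by auto
  from lazy_request[OF this \<sigma>1, of "e * g" "e * g"]
  have "lazy \<sigma>2 (e * g) (- e * f) (L + 1) \<or> lazy \<sigma>2 (e * g) ?t (L + f + g)"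
    unfolding near far by (simp add: \<sigma>2_def add.assoc)
  moreover have "offline \<sigma>2 (e * g) (- e * f) (g + 1)"
    using offline_first[OF offline_first[OF t(2), of t ?t], of "e * g" "e * g"] near
    by (simp add: \<sigma>1_def \<sigma>2_def)
  moreover have "offline \<sigma>2 (e * g) ?t f"
    using offline_second[OF offline_first[OF t(3), of t ?t, simplified], of "e * g"]
    by (simp add: \<sigma>1_def \<sigma>2_def)
  ultimately show ?thesis
    using \<sigma>2 e fg by (intro exI[of _ \<sigma>2]) (auto simp: game_def)
qed

section \<open>From the game to the competitive ratio\<close>

lemma opt_cost_le_offline:
  assumes "offline \<sigma> t y w"
  shows "opt_cost M d C0 \<sigma> \<le> real_of_int w"
proof -
  obtain Ts where Ts: "reaches M C0 \<sigma> Ts {#\<iota> t, \<iota> y#}" "schedule_cost d Ts \<le> real_of_int w"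
    using assms by (auto simp: offline_def)
  have "opt_cost M d C0 \<sigma> \<le> schedule_cost d Ts"
    unfolding opt_cost_def
  proof (rule cInf_lower)
    show "bdd_below {schedule_cost d Ts |Ts. valid_schedule M C0 \<sigma> Ts}"
      by (rule bdd_belowI[of _ 0]) (auto intro!: schedule_cost_nonneg simp: d_def)
  qed (use reaches_imp_valid[OF Ts(1)] in blast)
  with Ts(2) show ?thesis by linarith
qed

lemma ratio_ge_9:
  assumes "competitive 2 A M d \<rho>"
  shows "9 \<le> \<rho>"
proof -
  \<comment> \<open>Ensures \<open>8 \<le> \<rho>'\<close> for \<open>cow_path\<close>; since
    \<open>8 < 9\<close>, the conclusion \<open>9 \<le> \<rho>'\<close> still yields
    \<open>9 \<le> \<rho>\<close>.\<close>
  define \<rho>' where "\<rho>' = max \<rho> 8"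
  have "8 \<le> \<rho>'" "\<rho> \<le> \<rho>'" by (auto simp: \<rho>'_def)
  obtain c where c: "\<And>\<sigma>. set \<sigma> \<subseteq> M \<times> M \<Longrightarrow> schedule_cost d (alg \<sigma>) \<le> \<rho> * opt_cost M d C0 \<sigma> + c"
    using assms initial_line unfolding competitive_def by blast
  have bound: "real_of_int L \<le> \<rho>' * w + c" if "set \<sigma> \<subseteq> M \<times> M" "lazy \<sigma> t y L" "offline \<sigma> t' y' w"
    for \<sigma> t y L t' y' w
  proof -
    have valid: "valid_schedule M C0 \<sigma> (alg \<sigma>)"
      using online metric_line initial_line that(1) by (auto simp: online_algorithm_def)
    have "0 \<le> opt_cost M d C0 \<sigma>"
      unfolding opt_cost_def using valid
      by (intro cInf_greatest) (auto intro!: schedule_cost_nonneg simp: d_def)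
    then have "\<rho> * opt_cost M d C0 \<sigma> \<le> \<rho>' * opt_cost M d C0 \<sigma>"
      using \<open>\<rho> \<le> \<rho>'\<close> by (rule mult_right_mono[rotated])
    also have "\<dots> \<le> \<rho>' * w"
      using opt_cost_le_offline[OF that(3)] \<open>8 \<le> \<rho>'\<close> by (intro mult_left_mono) auto
    moreover have "real_of_int L \<le> schedule_cost d (alg \<sigma>)"
      using that(2) by (auto simp: lazy_def)
    ultimately show ?thesis
      using c[OF that(1)] by linarith
  qed
  \<comment> \<open>The request sequences behind successive states may be unrelated:
    \<open>c\<close> is independent of \<open>\<sigma>\<close>, so the bounds hold for each of them
    separately.\<close>
  define P where "P = (\<lambda>(n::nat) (e, f, g, L). (\<exists>\<sigma>. game \<sigma> e f g L) \<and>
    (n = 0 \<longrightarrow> f = 0 \<and> g = 0 \<and> L = 0))"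
  define R where "R = (\<lambda>(n::nat) (e::int, f::int, g::int, L::int) (e'::int, f', g', L').
    f' = f \<and> g' = g + 1 \<and> L' = L + 1 \<or> f' = g + 1 \<and> g' = f \<and> L' = L + f + g)"
  have "\<exists>S. P 0 S"
    using game_init by (auto simp: P_def)
  moreover have "\<exists>S'. P (Suc n) S' \<and> R n S S'" if "P n S" for n S
  proof -
    obtain e f g L where S: "S = (e, f, g, L)" by (cases S)
    then obtain \<sigma> where "game \<sigma> e f g L"
      using \<open>P n S\<close> by (auto simp: P_def)
    from game_step[OF this] show ?thesis
      unfolding P_def R_def S by fastforce
  qed
  ultimately obtain S where S: "\<And>n. P n (S n)" "\<And>n. R n (S n) (S (Suc n))"
    using dependent_nat_choice[of P R] by blast
  define f g L where "f n = real_of_int (fst (snd (S n)))"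
    and "g n = real_of_int (fst (snd (snd (S n))))"
    and "L n = real_of_int (snd (snd (snd (S n))))" for n
  have "9 \<le> \<rho>'"
  proof (rule cow_path[of f g L])
    show "f 0 = 0" "g 0 = 0" "L 0 = 0"
      using S(1)[of 0] by (auto simp: P_def f_def g_def L_def split: prod.splits)
    show "f (Suc n) = f n \<and> g (Suc n) = g n + 1 \<and> L (Suc n) = L n + 1 \<or>
        f (Suc n) = g n + 1 \<and> g (Suc n) = f n \<and> L (Suc n) = L n + f n + g n" for n
      using S(2)[of n] by (auto simp: R_def f_def g_def L_def split: prod.splits)
    fix n
    obtain e f' g' L' where Sn: "S n = (e, f', g', L')" by (cases "S n")
    obtain \<sigma> where "game \<sigma> e f' g' L'"
      using S(1)[of n] by (auto simp: P_def Sn)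
    then show "L n \<le> \<rho>' * f n + c" "L n \<le> \<rho>' * g n + c"
      using bound by (auto simp: game_def f_def g_def L_def Sn)
  qed (rule \<open>8 \<le> \<rho>'\<close>)
  then show ?thesis
    by (simp add: \<rho>'_def max_def split: if_splits)
qed

end

theorem theorem4:
  assumes "infinite (UNIV :: 'a set)"
  shows "hard_taxi_ratio TYPE('a) 2 = 9"
proof (rule antisym)
  have "online_algorithm 2 (biased_double_coverage :: 'a algorithm)"
    by (rule biased_double_coverage_online)
  then have "hard_taxi_ratio TYPE('a) 2 \<le> ereal 9"
    unfolding hard_taxi_ratio_def
    by (intro Inf_lower) (use biased_double_coverage_competitive in blast)
  then show "hard_taxi_ratio TYPE('a) 2 \<le> 9"
    by simp
next
  obtain h :: "nat \<Rightarrow> 'a" where "inj h"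
    using assms by (auto simp: infinite_iff_countable_subset)
  then have inj: "inj (h \<circ> to_nat :: int \<Rightarrow> 'a)"
    by (intro inj_compose inj_to_nat)
  show "9 \<le> hard_taxi_ratio TYPE('a) 2"
    unfolding hard_taxi_ratio_def
  proof (rule Inf_greatest)
    fix r assume "r \<in> {ereal \<rho> |\<rho>. \<exists>A :: 'a algorithm. online_algorithm 2 A \<and>
      (\<forall>M d. Metric_space M d \<longrightarrow> competitive 2 A M d \<rho>)}"
    then obtain \<rho> and A :: "'a algorithm" where r: "r = ereal \<rho>" and A: "online_algorithm 2 A"
      and comp: "\<And>M d. Metric_space M d \<Longrightarrow> competitive 2 A M d \<rho>"
      by blast
    interpret integer_line "h \<circ> to_nat" A
      by unfold_locales (rule inj, rule A)
    have "ereal 9 \<le> r"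
      unfolding r ereal_less_eq by (rule ratio_ge_9[OF comp[OF metric_line]])
    then show "9 \<le> r"
      by simp
  qed
qed

end
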